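(* Let $\nu$ be a $\rhd$-infinitely divisible probability measure on $\mathbb{R}$ which has an isolated atom at $a\in\mathbb{R}$, i.e. $\nu(\{a\})>0$ and $a\notin\overline{\operatorname{supp}\nu\setminus\{a\}}$. Then $\nu=\nu(\{a\})\delta_a+\nu_{ac}$, where $\nu_{ac}$ is absolutely continuous with respect to Lebesgue measure and $a\notin\operatorname{supp}\nu_{ac}$. Moreover, $$\{u\in\operatorname{supp}\nu\setminus\{a\}:\ \limsup_{v\searrow0}|G_\nu(u+iv)|=\infty\}=\emptyset.$$
   Context: For a probability measure $\mu$ on $\mathbb{R}$, $G_\mu(z)=\int\frac{1}{z-x}d\mu(x)$ for $z\in\mathbb{C}^+$ and $H_\mu=1/G_\mu$. The monotone convolution $\mu\rhd\nu$ is the unique probability measure with $H_{\mu\rhd\nu}=H_\mu\circ H_\nu$; $\mu^{\rhd k}$ is the $k$-fold power. $\nu$ is $\rhd$-infinitely divisible if for every integer $k\ge1$ there is a probability measure $\nu_k$ with $\nu=\nu_k^{\rhd k}$. *)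

theory Defs
  imports "HOL-Probability.Probability"
begin

definition prob_meas_R :: "real measure \<Rightarrow> bool" where
  "prob_meas_R \<mu> \<longleftrightarrow> prob_space \<mu> \<and> sets \<mu> = sets borel"

definition cauchy_G :: "real measure \<Rightarrow> complex \<Rightarrow> complex" where
  "cauchy_G \<mu> z = (\<integral>x. 1 / (z - complex_of_real x) \<partial>\<mu>)"

definition recip_H :: "real measure \<Rightarrow> complex \<Rightarrow> complex" where
  "recip_H \<mu> z = 1 / cauchy_G \<mu> z"

text \<open>rho is the monotone convolution of mu and nu: H_rho = H_mu o H_nu on C+.
  (It is unique, since the Cauchy transform determines the measure.)\<close>
definition is_mconv :: "real measure \<Rightarrow> real measure \<Rightarrow> real measure \<Rightarrow> bool" where
  "is_mconv \<mu> \<nu> \<rho> \<longleftrightarrow> prob_meas_R \<rho> \<and>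
     (\<forall>z. 0 < Im z \<longrightarrow> recip_H \<rho> z = recip_H \<mu> (recip_H \<nu> z))"

inductive is_mpow :: "real measure \<Rightarrow> nat \<Rightarrow> real measure \<Rightarrow> bool" for \<mu> where
  one: "is_mpow \<mu> (Suc 0) \<mu>"
| step: "is_mpow \<mu> k \<rho> \<Longrightarrow> is_mconv \<mu> \<rho> \<sigma> \<Longrightarrow> is_mpow \<mu> (Suc k) \<sigma>"

definition mono_inf_div :: "real measure \<Rightarrow> bool" where
  "mono_inf_div \<nu> \<longleftrightarrow> (\<forall>k::nat. 1 \<le> k \<longrightarrow> (\<exists>\<nu>k. prob_meas_R \<nu>k \<and> is_mpow \<nu>k k \<nu>))"

definition supp_meas :: "real measure \<Rightarrow> real set" where
  "supp_meas \<mu> = {x. \<forall>e>0. 0 < emeasure \<mu> (ball x e)}"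

end

theory Submission
  imports Defs
begin

text \<open>The key point is that $H_\nu$ is injective on the upper half-plane. Near the isolated atom
  $H_\nu$ extends analytically with $H_\nu(a) = 0$, so every small $w$ in the upper half-plane is
  $H_\nu(\zeta)$ for some $\zeta$ close to $a$; by injectivity $|H_\nu|$ is bounded below, that is,
  $|G_\nu|$ is bounded, away from $a$. Boundedness of $G_\nu$ rules out blow-up at the other points
  and forces the rest of $\nu$ to have a bounded density.

  Injectivity comes from the compositional roots $f = H_{\nu_k}$ without embedding $\nu$ into a
  semigroup. The Schwarz-Pick inequality for $f^m - \mathrm{id}$ (a Cauchy-Schwarz inequality, as the
  Nevanlinna kernel is a covariance), applied at $iy$ with $y$ large, gives $f - \mathrm{id} = O(1/k)$
  pointwise. If $H_\nu$ identified two points, their $f$-orbits would merge at some step, which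
  Schwarz-Pick forbids as long as the steps of both orbits are smaller than their imaginary parts.\<close>

subsection \<open>Iteration of Schwarz-Pick maps\<close>

text \<open>The second condition is the Schwarz-Pick inequality for $f - \mathrm{id}$, cleared of denominators.
  It replaces holomorphy of $f$ everywhere below.\<close>
definition pick_map :: "(complex \<Rightarrow> complex) \<Rightarrow> bool" where
  "pick_map f \<longleftrightarrow> (\<forall>a. 0 < Im a \<longrightarrow> Im a \<le> Im (f a)) \<and>
     (\<forall>a b. 0 < Im a \<longrightarrow> 0 < Im b \<longrightarrow>
        (cmod ((f a - a) - (f b - b)))\<^sup>2 * (Im a * Im b)
          \<le> Im (f a - a) * Im (f b - b) * (cmod (a - b))\<^sup>2)"

lemma pick_map_Im: "pick_map f \<Longrightarrow> 0 < Im a \<Longrightarrow> Im a \<le> Im (f a)"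
  by (simp add: pick_map_def)

lemma pick_map_dist:
  "pick_map f \<Longrightarrow> 0 < Im a \<Longrightarrow> 0 < Im b \<Longrightarrow>
     (cmod ((f a - a) - (f b - b)))\<^sup>2 * (Im a * Im b)
       \<le> Im (f a - a) * Im (f b - b) * (cmod (a - b))\<^sup>2"
  by (simp add: pick_map_def)

lemma pick_map_id: "pick_map id"
  by (simp add: pick_map_def)

lemma pick_map_cong:
  assumes "pick_map f" "\<And>z. 0 < Im z \<Longrightarrow> g z = f z"
  shows "pick_map g"
  using assms by (simp add: pick_map_def)

text \<open>With \<alpha>, \<beta> the imaginary parts of the two displacements and D the distance
  between them, Schwarz-Pick reads D^2 <= \<alpha> \<beta> R, while |\<alpha> - \<beta>| <= D. So
  (\<alpha> - \<beta>)^2 <= \<alpha> \<beta> R, which forces \<beta> <= (2 + R) \<alpha>;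
  reinserting this bounds D. This is Harnack's inequality for the nonnegative function Im (f -
  id).\<close>

lemma pick_map_harnack:
  fixes R :: real
  assumes f: "pick_map f" and a: "0 < Im a" and b: "0 < Im b"
    and R: "(cmod (a - b))\<^sup>2 \<le> R * (Im a * Im b)"
  shows "Im (f b - b) \<le> (2 + R) * Im (f a - a)"
    and "cmod ((f a - a) - (f b - b)) \<le> (2 + R) * Im (f a - a)"
proof -
  define \<alpha> \<beta> where "\<alpha> = Im (f a - a)" and "\<beta> = Im (f b - b)"
  define D where "D = cmod ((f a - a) - (f b - b))"
  have ab: "0 < Im a * Im b" using a b by simp
  have \<alpha>: "0 \<le> \<alpha>" and \<beta>: "0 \<le> \<beta>"
    using pick_map_Im[OF f a] pick_map_Im[OF f b] by (auto simp: \<alpha>_def \<beta>_def)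
  have "D\<^sup>2 * (Im a * Im b) \<le> \<alpha> * \<beta> * (cmod (a - b))\<^sup>2"
    using pick_map_dist[OF f a b] by (simp add: D_def \<alpha>_def \<beta>_def)
  also have "\<dots> \<le> \<alpha> * \<beta> * (R * (Im a * Im b))"
    using R \<alpha> \<beta> by (intro mult_left_mono) auto
  finally have "D\<^sup>2 * (Im a * Im b) \<le> (\<alpha> * \<beta> * R) * (Im a * Im b)" by (simp add: mult.assoc)
  then have D2: "D\<^sup>2 \<le> \<alpha> * \<beta> * R" using ab by (rule mult_right_le_imp_le)
  have R0: "0 \<le> R"
    using ab R mult_neg_pos[of R "Im a * Im b"] zero_le_power2[of "cmod (a - b)"] by linarith
  have "\<bar>\<alpha> - \<beta>\<bar> \<le> D"
    using abs_Im_le_cmod[of "(f a - a) - (f b - b)"] by (simp add: D_def \<alpha>_def \<beta>_def)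
  then have "(\<alpha> - \<beta>)\<^sup>2 \<le> D\<^sup>2"
    using power_mono[of "\<bar>\<alpha> - \<beta>\<bar>" D 2] by simp
  moreover have "(\<alpha> - \<beta>)\<^sup>2 = \<alpha>\<^sup>2 + \<beta> * \<beta> + \<alpha> * \<beta> * R - ((2 + R) * \<alpha>) * \<beta>"
    by (simp add: power2_eq_square algebra_simps)
  ultimately have "\<beta> * \<beta> \<le> ((2 + R) * \<alpha>) * \<beta>"
    using zero_le_power2[of \<alpha>] D2 by linarith
  then have B: "\<beta> \<le> (2 + R) * \<alpha>"
  proof (cases "\<beta> = 0")
    case False
    with \<beta> have "0 < \<beta>" by simp
    with \<open>\<beta> * \<beta> \<le> ((2 + R) * \<alpha>) * \<beta>\<close> show ?thesis by (rule mult_right_le_imp_le)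
  qed (use \<alpha> R0 in simp)
  then show "Im (f b - b) \<le> (2 + R) * Im (f a - a)" by (simp add: \<alpha>_def \<beta>_def)
  have "D\<^sup>2 \<le> \<alpha> * ((2 + R) * \<alpha>) * R"
    using mult_right_mono[OF mult_left_mono[OF B \<alpha>] R0] D2 by linarith
  also have "\<dots> \<le> \<alpha> * ((2 + R) * \<alpha>) * (2 + R)"
    using \<alpha> R0 by (intro mult_left_mono) auto
  also have "\<dots> = ((2 + R) * \<alpha>)\<^sup>2" by (simp add: power2_eq_square)
  finally have "D \<le> (2 + R) * \<alpha>"
    by (rule power2_le_imp_le) (use \<alpha> R0 in simp)
  then show "cmod ((f a - a) - (f b - b)) \<le> (2 + R) * Im (f a - a)"
    by (simp add: \<alpha>_def D_def)
qed

text \<open>Passing from f - id back to f costs a triangle inequality, whose cross term is absorbed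
  by the arithmetic-geometric mean inequality. The quotient |a - b|^2 / (Im a Im b) is an increasing
  function of the hyperbolic distance, so this is the Schwarz-Pick inequality for f itself.\<close>

lemma pick_map_contraction:
  assumes f: "pick_map f" and a: "0 < Im a" and b: "0 < Im b"
  shows "(cmod (f a - f b))\<^sup>2 * (Im a * Im b) \<le> (cmod (a - b))\<^sup>2 * (Im (f a) * Im (f b))"
proof -
  define \<alpha> \<beta> where "\<alpha> = Im (f a - a)" and "\<beta> = Im (f b - b)"
  define D where "D = cmod ((f a - a) - (f b - b))"
  define E where "E = cmod (a - b)"
  define P where "P = Im a * Im b"
  have P: "0 < P" using a b by (simp add: P_def)
  have \<alpha>: "0 \<le> \<alpha>" and \<beta>: "0 \<le> \<beta>"
    using pick_map_Im[OF f a] pick_map_Im[OF f b] by (auto simp: \<alpha>_def \<beta>_def)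
  have D2: "D\<^sup>2 * P \<le> \<alpha> * \<beta> * E\<^sup>2"
    using pick_map_dist[OF f a b] by (simp add: D_def E_def P_def \<alpha>_def \<beta>_def)
  have "cmod (f a - f b) \<le> E + D"
    using norm_triangle_ineq[of "a - b" "(f a - a) - (f b - b)"] by (simp add: D_def E_def)
  then have "(cmod (f a - f b))\<^sup>2 \<le> (E + D)\<^sup>2" by (simp add: power_mono)
  then have 1: "(cmod (f a - f b))\<^sup>2 * P \<le> (E + D)\<^sup>2 * P" using P by simp
  \<comment> \<open>After squaring, \<open>D2\<close> replaces D^2 P by \<alpha> \<beta> E^2; what
    remains is 4 x y <= (x + y)^2 with x = \<alpha> Im b and y = \<beta> Im a.\<close>
  have 2: "2 * (E * D * P) \<le> E\<^sup>2 * (\<alpha> * Im b + \<beta> * Im a)"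
  proof (rule power2_le_imp_le)
    have "(2 * (E * D * P))\<^sup>2 = 4 * E\<^sup>2 * P * (D\<^sup>2 * P)" by (simp add: power2_eq_square)
    also have "\<dots> \<le> 4 * E\<^sup>2 * P * (\<alpha> * \<beta> * E\<^sup>2)" using P D2 by (intro mult_left_mono) auto
    also have "\<dots> = E\<^sup>2 * E\<^sup>2 * (4 * ((\<alpha> * Im b) * (\<beta> * Im a)))" by (simp add: P_def)
    also have "\<dots> \<le> E\<^sup>2 * E\<^sup>2 * (\<alpha> * Im b + \<beta> * Im a)\<^sup>2"
      using sum_squares_bound[of "\<alpha> * Im b" "\<beta> * Im a"]
      by (intro mult_left_mono) (auto simp: power2_sum mult_ac)
    finally show "(2 * (E * D * P))\<^sup>2 \<le> (E\<^sup>2 * (\<alpha> * Im b + \<beta> * Im a))\<^sup>2"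
      by (simp add: power2_eq_square mult_ac)
  qed (use \<alpha> \<beta> a b in auto)
  have "(E + D)\<^sup>2 * P = E\<^sup>2 * P + 2 * (E * D * P) + D\<^sup>2 * P"
    by (simp add: power2_eq_square algebra_simps)
  also have "\<dots> \<le> E\<^sup>2 * P + E\<^sup>2 * (\<alpha> * Im b + \<beta> * Im a) + \<alpha> * \<beta> * E\<^sup>2" using 2 D2 by simp
  also have "\<dots> = E\<^sup>2 * ((Im a + \<alpha>) * (Im b + \<beta>))" by (simp add: P_def algebra_simps)
  finally show ?thesis using 1 by (simp add: P_def E_def \<alpha>_def \<beta>_def)
qed

section \<open>Orbits and the displacement of compositional roots\<close>

lemma funpow_pick_map_Im_mono:
  assumes f: "pick_map f" and z: "0 < Im z" and "i \<le> j"
  shows "Im ((f ^^ i) z) \<le> Im ((f ^^ j) z)"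
proof -
  have pos: "0 < Im ((f ^^ n) z)" for n
    by (induction n) (use z pick_map_Im[OF f] in \<open>force+\<close>)
  show ?thesis
    using \<open>i \<le> j\<close>
  proof (induction rule: dec_induct)
    case (step n)
    then show ?case using pick_map_Im[OF f pos[of n]] by simp
  qed simp
qed

lemma funpow_pick_map_Im_pos:
  assumes "pick_map f" "0 < Im z"
  shows "0 < Im ((f ^^ n) z)"
  using funpow_pick_map_Im_mono[OF assms, of 0 n] assms(2) by simp

text \<open>By the contraction, |w_{j+1} - w_j|^2 / (Im w_{j+1} Im w_j) does not increase along the
  orbit. Since imaginary parts grow, this also controls the Euclidean length of a step by that of
  the first one.\<close>

lemma funpow_pick_map_step:
  assumes f: "pick_map f" and z: "0 < Im z"
  shows "(cmod (f ((f ^^ j) z) - (f ^^ j) z))\<^sup>2 * (Im z)\<^sup>2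
          \<le> (cmod (f z - z))\<^sup>2 * (Im ((f ^^ Suc j) z))\<^sup>2"
proof -
  let ?w = "\<lambda>j. (f ^^ j) z"
  have pos: "0 < Im (?w n)" for n by (rule funpow_pick_map_Im_pos[OF f z])
  have *: "(cmod (?w (Suc j) - ?w j))\<^sup>2 * (Im (?w 0) * Im (?w 1))
     \<le> (cmod (?w 1 - ?w 0))\<^sup>2 * (Im (?w (Suc j)) * Im (?w j))" for j
  proof (induction j)
    case 0 show ?case by simp
  next
    case (Suc j)
    let ?P = "Im (?w (Suc j)) * Im (?w j)" and ?Q = "Im (?w (Suc (Suc j))) * Im (?w (Suc j))"
    let ?R = "Im (?w 0) * Im (?w 1)"
    have "(cmod (?w (Suc (Suc j)) - ?w (Suc j)))\<^sup>2 * ?P \<le> (cmod (?w (Suc j) - ?w j))\<^sup>2 * ?Q"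
      using pick_map_contraction[OF f pos[of "Suc j"] pos[of j]] by simp
    then have "((cmod (?w (Suc (Suc j)) - ?w (Suc j)))\<^sup>2 * ?P) * ?R
        \<le> ((cmod (?w (Suc j) - ?w j))\<^sup>2 * ?Q) * ?R"
      using pos[of 0] pos[of 1] by (intro mult_right_mono) auto
    then have "(cmod (?w (Suc (Suc j)) - ?w (Suc j)))\<^sup>2 * ?R * ?P
        \<le> (cmod (?w (Suc j) - ?w j))\<^sup>2 * ?R * ?Q"
      by (simp only: mult_ac)
    also have "\<dots> \<le> (cmod (?w 1 - ?w 0))\<^sup>2 * ?P * ?Q"
      using Suc by (rule mult_right_mono) (rule less_imp_le[OF mult_pos_pos[OF pos pos]])
    also have "\<dots> = (cmod (?w 1 - ?w 0))\<^sup>2 * ?Q * ?P" by (simp only: mult_ac)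
    finally show ?case
      using mult_pos_pos[OF pos[of "Suc j"] pos[of j]] by (rule mult_right_le_imp_le)
  qed
  have "(cmod (?w (Suc j) - ?w j))\<^sup>2 * (Im z)\<^sup>2 \<le> (cmod (?w (Suc j) - ?w j))\<^sup>2 * (Im (?w 0) * Im (?w 1))"
    using pick_map_Im[OF f z] z by (intro mult_left_mono) (auto simp: power2_eq_square)
  also have "\<dots> \<le> (cmod (?w 1 - ?w 0))\<^sup>2 * (Im (?w (Suc j)) * Im (?w j))" by (rule *)
  also have "\<dots> \<le> (cmod (?w 1 - ?w 0))\<^sup>2 * (Im (?w (Suc j)))\<^sup>2"
    using pos[of j] pick_map_Im[OF f pos[of j]]
    by (intro mult_left_mono) (auto simp: power2_eq_square)
  finally show ?thesis by simp
qed

text \<open>Since $f^n - \mathrm{id}$ is $1/4$-Lipschitz along the orbit $w_j = f^j(z)$, the point $w_n$ farthest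
  from $z$ satisfies $w_{2n} - z \approx 2 (w_n - z)$; but $w_{2n}$ is one of the $w_j$, up to one
  application of $f^k$.\<close>
lemma iterates_stay_close:
  assumes P: "\<And>m. m \<le> k \<Longrightarrow> pick_map (f ^^ m)" and k: "1 \<le> k"
    and z: "0 < Im z" and \<theta>: "Im ((f ^^ (2 * k)) z) - Im z \<le> Im z / 4"
    and m: "m \<le> k"
  shows "cmod ((f ^^ m) z - z) \<le> 2 * cmod ((f ^^ k) z - z)"
proof -
  have f: "pick_map f" using P[of 1] k by simp
  let ?w = "\<lambda>j. (f ^^ j) z"
  have pos: "0 < Im (?w n)" for n by (rule funpow_pick_map_Im_pos[OF f z])
  have mono: "i \<le> j \<Longrightarrow> Im (?w i) \<le> Im (?w j)" for i j by (rule funpow_pick_map_Im_mono[OF f z])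
  have add: "(f ^^ i) (?w j) = ?w (i + j)" for i j by (simp add: funpow_add)
  \<comment> \<open>Schwarz-Pick for f^n between w_i and z. As n + i <= 2k, hypothesis
    \<open>\<theta>\<close> bounds both imaginary displacements by Im z / 4, whence the factor
    1/4.\<close>
  have lip: "cmod ((?w (n + i) - ?w i) - (?w n - z)) \<le> cmod (?w i - z) / 4"
    if "n \<le> k" "i \<le> k" for n i
  proof (rule power2_le_imp_le)
    let ?D = "cmod ((?w (n + i) - ?w i) - (?w n - z))"
    have A: "0 \<le> Im (?w (n + i)) - Im (?w i)" "Im (?w (n + i)) - Im (?w i) \<le> Im z / 4"
      using mono[of i "n + i"] mono[of "n + i" "2 * k"] mono[of 0 i] \<theta> that by auto
    have B: "0 \<le> Im (?w n) - Im z" "Im (?w n) - Im z \<le> Im z / 4"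
      using mono[of 0 n] mono[of n "2 * k"] \<theta> that by auto
    have "?D\<^sup>2 * (Im z * Im z) \<le> ?D\<^sup>2 * (Im (?w i) * Im z)"
      using mono[of 0 i] z by (intro mult_left_mono mult_right_mono) auto
    also have "\<dots> \<le> (Im (?w (n + i)) - Im (?w i)) * (Im (?w n) - Im z) * (cmod (?w i - z))\<^sup>2"
      using pick_map_dist[OF P[OF \<open>n \<le> k\<close>] pos[of i] z] by (simp add: add)
    also have "\<dots> \<le> (Im z / 4) * (Im z / 4) * (cmod (?w i - z))\<^sup>2"
      using A B by (intro mult_right_mono mult_mono) auto
    also have "\<dots> = (cmod (?w i - z) / 4)\<^sup>2 * (Im z * Im z)" by (simp add: power2_eq_square)
    finally show "?D\<^sup>2 \<le> (cmod (?w i - z) / 4)\<^sup>2"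
      using z by (simp add: mult_le_cancel_right)
  qed auto
  define L where "L = Max ((\<lambda>m. cmod (?w m - z)) ` {..k})"
  have le_L: "cmod (?w m - z) \<le> L" if "m \<le> k" for m
    unfolding L_def using that by (intro Max_ge) auto
  have "L \<in> (\<lambda>m. cmod (?w m - z)) ` {..k}"
    unfolding L_def by (intro Max_in) auto
  then obtain n where n: "n \<le> k" "cmod (?w n - z) = L" by auto
  let ?B = "cmod (?w k - z)"
  \<comment> \<open>If 2n exceeds k, write 2n = k + r: up to an error L / 4, the map f^k displaces
    w_r as it displaces z.\<close>
  have up: "cmod (?w (n + n) - z) \<le> L + L / 4 + ?B"
  proof (cases "n + n \<le> k")
    case True
    have "0 \<le> L" using n(2) norm_ge_zero by metis
    then show ?thesis using le_L[OF True] norm_ge_zero[of "?w k - z"] by linarith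
  next
    case False
    define r where "r = n + n - k"
    have r: "r \<le> k" "n + n = k + r" using False n by (auto simp: r_def)
    have "cmod ((?w (k + r) - ?w r) - (?w k - z)) \<le> L / 4"
      using lip[of k r] le_L[OF r(1)] r by simp
    moreover have "?w (k + r) - z = (?w r - z) + ((?w (k + r) - ?w r) - (?w k - z)) + (?w k - z)"
      by simp
    then have "cmod (?w (k + r) - z) \<le> cmod (?w r - z) + cmod ((?w (k + r) - ?w r) - (?w k - z)) + ?B"
      by (metis norm_triangle_mono norm_triangle_ineq order_refl)
    ultimately show ?thesis using le_L[OF r(1)] r by simp
  qed
  have "2 * (?w n - z) = (?w (n + n) - z) - ((?w (n + n) - ?w n) - (?w n - z))" by simp
  then have "cmod (2 * (?w n - z)) \<le> cmod (?w (n + n) - z) + cmod ((?w (n + n) - ?w n) - (?w n - z))"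
    by (metis norm_triangle_ineq4)
  then have "2 * L \<le> cmod (?w (n + n) - z) + L / 4"
    using lip[OF n(1) n(1)] n(2) by (simp only: norm_mult norm_numeral)
  \<comment> \<open>2 L <= (L + L/4 + B) + L/4 leaves L/2 <= B, where B = |w_k - z|.\<close>
  then have "L \<le> 2 * ?B" using up by linarith
  then show ?thesis using le_L[OF m] by linarith
qed

text \<open>The k steps of the orbit add up to f^k(z) - z, and all their starting points are
  hyperbolically close to z. By Harnack every step has an imaginary part comparable to that of the
  first, so k times the first is at most a multiple of the sum. The imaginary part then controls how
  much the steps differ, hence the full displacement. The constants depend only on z and
  f^k(z).\<close>

lemma root_displacement:
  assumes P: "\<And>m. m \<le> k \<Longrightarrow> pick_map (f ^^ m)" and k: "1 \<le> k"
    and z: "0 < Im z" and \<theta>: "Im ((f ^^ (2 * k)) z) - Im z \<le> Im z / 4"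
    and B: "B = cmod ((f ^^ k) z - z)" and R: "R = 4 * B\<^sup>2 / (Im z)\<^sup>2"
  shows "k * Im (f z - z) \<le> (2 + R) * B"
    and "k * cmod (f z - z) \<le> B + (2 + R)\<^sup>2 * B"
proof -
  have f: "pick_map f" using P[of 1] k by simp
  let ?w = "\<lambda>j. (f ^^ j) z"
  have pos: "0 < Im (?w n)" for n by (rule funpow_pick_map_Im_pos[OF f z])
  \<comment> \<open>The value of R comes from here: w_j lies within 2 B of z, and Im w_j >= Im
    z.\<close>
  have close: "(cmod (z - ?w j))\<^sup>2 \<le> R * (Im z * Im (?w j))" if "j \<le> k" for j
  proof -
    have "cmod (z - ?w j) \<le> 2 * B"
      using iterates_stay_close[OF P k z \<theta> that] by (simp add: B norm_minus_commute)
    then have "(cmod (z - ?w j))\<^sup>2 \<le> (2 * B)\<^sup>2" by (rule power_mono) simp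
    also have "\<dots> = R * (Im z * Im z)" using z by (simp add: R power2_eq_square)
    also have "\<dots> \<le> R * (Im z * Im (?w j))"
      using funpow_pick_map_Im_mono[OF f z, of 0 j] z by (intro mult_left_mono) (auto simp: R)
    finally show ?thesis .
  qed
  have R0: "0 \<le> R" by (simp add: R)
  have tel: "(\<Sum>j<k. f (?w j) - ?w j) = ?w k - z"
    using sum_lessThan_telescope[of ?w k] by simp
  have low: "Im (f z - z) \<le> (2 + R) * Im (f (?w j) - ?w j)" if "j < k" for j
    by (rule pick_map_harnack[OF f pos z])
      (use close[of j] that in \<open>simp add: norm_minus_commute mult.commute\<close>)
  have "k * Im (f z - z) = (\<Sum>j<k. Im (f z - z))" by simp
  also have "\<dots> \<le> (\<Sum>j<k. (2 + R) * Im (f (?w j) - ?w j))" using low by (intro sum_mono) auto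
  also have "\<dots> = (2 + R) * Im (?w k - z)"
    by (simp add: sum_distrib_left[symmetric] tel[symmetric])
  also have "\<dots> \<le> (2 + R) * B"
    using R0 abs_Im_le_cmod[of "?w k - z"] unfolding B by (intro mult_left_mono) auto
  finally show 1: "k * Im (f z - z) \<le> (2 + R) * B" .
  have near: "cmod ((f z - z) - (f (?w j) - ?w j)) \<le> (2 + R) * Im (f z - z)" if "j < k" for j
    by (rule pick_map_harnack[OF f z pos]) (use close[of j] that in auto)
  have split: "k * (f z - z) = (\<Sum>j<k. (f z - z) - (f (?w j) - ?w j)) + (?w k - z)"
    using tel by (simp add: sum_subtractf)
  have "cmod (k * (f z - z)) \<le> (\<Sum>j<k. cmod ((f z - z) - (f (?w j) - ?w j))) + B"
    unfolding split B by (rule norm_triangle_mono[OF norm_sum order_refl])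
  also have "\<dots> \<le> (\<Sum>j<k. (2 + R) * Im (f z - z)) + B"
    using near by (intro add_right_mono sum_mono) auto
  also have "\<dots> = (2 + R) * (k * Im (f z - z)) + B" by simp
  also have "\<dots> \<le> (2 + R) * ((2 + R) * B) + B"
    using 1 R0 by (intro add_right_mono mult_left_mono) auto
  finally show "k * cmod (f z - z) \<le> B + (2 + R)\<^sup>2 * B"
    by (simp add: norm_mult power2_eq_square mult_ac)
qed

subsection \<open>Reciprocal Cauchy transforms are Schwarz-Pick maps\<close>

lemma cauchy_schwarz_integral:
  fixes f g :: "'a \<Rightarrow> complex"
  assumes f: "integrable M (\<lambda>x. (cmod (f x))\<^sup>2)" and g: "integrable M (\<lambda>x. (cmod (g x))\<^sup>2)"
    and fg: "integrable M (\<lambda>x. f x * g x)"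
  shows "(cmod (\<integral>x. f x * g x \<partial>M))\<^sup>2 \<le> (\<integral>x. (cmod (f x))\<^sup>2 \<partial>M) * (\<integral>x. (cmod (g x))\<^sup>2 \<partial>M)"
proof -
  define A B X where "A = (\<integral>x. (cmod (f x))\<^sup>2 \<partial>M)" and "B = (\<integral>x. (cmod (g x))\<^sup>2 \<partial>M)"
    and "X = (\<integral>x. cmod (f x) * cmod (g x) \<partial>M)"
  have n: "integrable M (\<lambda>x. cmod (f x) * cmod (g x))"
    using integrable_norm[OF fg] by (simp add: norm_mult)
  \<comment> \<open>A nonnegative quadratic in t; the inequality is the sign of its
    discriminant.\<close>
  have AX: "0 \<le> t\<^sup>2 * A - 2 * t * X + B" for t
  proof -
    have "0 \<le> (\<integral>x. (t * cmod (f x) - cmod (g x))\<^sup>2 \<partial>M)" by simp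
    also have "\<dots> = (\<integral>x. t\<^sup>2 * (cmod (f x))\<^sup>2 - 2 * t * (cmod (f x) * cmod (g x)) + (cmod (g x))\<^sup>2 \<partial>M)"
      by (simp add: power2_diff power_mult_distrib mult_ac algebra_simps)
    also have "\<dots> = t\<^sup>2 * A - 2 * t * X + B"
      using f g n by (simp add: A_def B_def X_def)
    finally show ?thesis .
  qed
  have A: "0 \<le> A" and X: "0 \<le> X" by (simp_all add: A_def X_def)
  have "X\<^sup>2 \<le> A * B"
  proof (cases "A = 0")
    case True
    have "X = 0"
    proof (rule ccontr)
      assume "X \<noteq> 0"
      \<comment> \<open>For A = 0 the quadratic is linear in t, and this t gives it the value
        -1.\<close>
      then show False using AX[of "(B + 1) / (2 * X)"] True by simp
    qed
    then show ?thesis using True by simp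
  next
    case False
    have "0 \<le> A * ((X / A)\<^sup>2 * A - 2 * (X / A) * X + B)"
      using AX[of "X / A"] A by (rule mult_nonneg_nonneg[rotated])
    also have "\<dots> = A * B - X\<^sup>2" using False by (simp add: power2_eq_square field_simps)
    finally show ?thesis by simp
  qed
  moreover have "cmod (\<integral>x. f x * g x \<partial>M) \<le> X"
    using integral_norm_bound[of M "\<lambda>x. f x * g x"] by (simp add: X_def norm_mult)
  then have "(cmod (\<integral>x. f x * g x \<partial>M))\<^sup>2 \<le> X\<^sup>2" by (rule power_mono) simp
  ultimately show ?thesis by (simp add: A_def B_def)
qed

section \<open>Cauchy transforms on the upper half-plane\<close>

lemma cmod_resolvent_le:
  assumes "0 < Im z"
  shows "cmod (1 / (z - complex_of_real x)) \<le> 1 / Im z"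
  using assms abs_Im_le_cmod[of "z - complex_of_real x"]
  by (simp add: norm_divide divide_simps)

lemma borel_measurable_real_measure:
  assumes "prob_meas_R \<mu>" "f \<in> borel_measurable borel"
  shows "f \<in> borel_measurable \<mu>"
  using assms by (subst measurable_cong_sets[of \<mu> borel]) (auto simp: prob_meas_R_def)

lemma integrable_bounded_real_measure:
  fixes f :: "real \<Rightarrow> 'b::{banach, second_countable_topology}"
  assumes \<mu>: "prob_meas_R \<mu>" and f: "f \<in> borel_measurable borel" and B: "\<And>x. norm (f x) \<le> B"
  shows "integrable \<mu> f"
proof -
  interpret prob_space \<mu> using \<mu> by (simp add: prob_meas_R_def)
  show ?thesis
    using borel_measurable_real_measure[OF \<mu> f] B by (intro integrable_const_bound[of _ B]) auto
qed

lemma integrable_resolvent: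
  assumes "prob_meas_R \<mu>" "0 < Im z"
  shows "integrable \<mu> (\<lambda>x. 1 / (z - complex_of_real x))"
  by (rule integrable_bounded_real_measure[OF assms(1) _ cmod_resolvent_le[OF assms(2)]]) measurable

lemma Im_cauchy_G:
  assumes \<mu>: "prob_meas_R \<mu>" and z: "0 < Im z"
  shows "Im (cauchy_G \<mu> z) = - (\<integral>x. Im z / (cmod (z - complex_of_real x))\<^sup>2 \<partial>\<mu>)"
proof -
  have "Im (cauchy_G \<mu> z) = (\<integral>x. Im (1 / (z - complex_of_real x)) \<partial>\<mu>)"
    unfolding cauchy_G_def using integrable_resolvent[OF \<mu> z] by simp
  also have "\<dots> = (\<integral>x. - (Im z / (cmod (z - complex_of_real x))\<^sup>2) \<partial>\<mu>)"
    by (simp add: Im_divide cmod_power2)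
  finally show ?thesis by simp
qed

lemma integrable_poisson_kernel:
  assumes \<mu>: "prob_meas_R \<mu>" and z: "0 < Im z"
  shows "integrable \<mu> (\<lambda>x. Im z / (cmod (z - complex_of_real x))\<^sup>2)"
proof -
  have "integrable \<mu> (\<lambda>x. - Im (1 / (z - complex_of_real x)))"
    using integrable_resolvent[OF \<mu> z] by simp
  then show ?thesis by (simp add: Im_divide cmod_power2)
qed

lemma Im_cauchy_G_neg:
  assumes \<mu>: "prob_meas_R \<mu>" and z: "0 < Im z"
  shows "Im (cauchy_G \<mu> z) < 0"
proof -
  interpret prob_space \<mu> using \<mu> by (simp add: prob_meas_R_def)
  let ?f = "\<lambda>x. Im z / (cmod (z - complex_of_real x))\<^sup>2"
  have pos: "0 < ?f x" for x
  proof -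
    have "z - complex_of_real x \<noteq> 0" using z by (auto simp: complex_eq_iff)
    then show ?thesis using z by simp
  qed
  have "(\<integral>x. ?f x \<partial>\<mu>) \<noteq> 0"
  proof
    assume "(\<integral>x. ?f x \<partial>\<mu>) = 0"
    then have "AE x in \<mu>. ?f x = 0"
      using integrable_poisson_kernel[OF \<mu> z] pos
      by (subst (asm) integral_nonneg_eq_0_iff_AE) (auto simp: less_imp_le)
    then have "AE x in \<mu>. False" by eventually_elim (use pos in \<open>metis less_irrefl\<close>)
    then show False by simp
  qed
  moreover have "0 \<le> (\<integral>x. ?f x \<partial>\<mu>)" using pos by (intro Bochner_Integration.integral_nonneg) (simp add: less_imp_le)
  ultimately show ?thesis using Im_cauchy_G[OF \<mu> z] by simp
qed

lemma cauchy_G_nonzero: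
  assumes "prob_meas_R \<mu>" "0 < Im z"
  shows "cauchy_G \<mu> z \<noteq> 0"
  using Im_cauchy_G_neg[OF assms] by auto

text \<open>The function U a is the resolvent at a divided by its mean, minus 1, so it has mean zero
  and the integral is a covariance. The resolvent identity evaluates it, and the result is the
  Nevanlinna kernel of H - id.\<close>

lemma nevanlinna_kernel:
  fixes \<mu> :: "real measure" and a b :: complex
  defines "U \<equiv> \<lambda>a x. 1 / (a - complex_of_real x) / cauchy_G \<mu> a - 1"
  assumes \<mu>: "prob_meas_R \<mu>" and a: "0 < Im a" and b: "0 < Im b"
  shows "integrable \<mu> (\<lambda>x. U a x * cnj (U b x))"
    and "(\<integral>x. U a x * cnj (U b x) \<partial>\<mu>)
           = ((recip_H \<mu> a - a) - cnj (recip_H \<mu> b - b)) / (a - cnj b)"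
proof -
  interpret prob_space \<mu> using \<mu> by (simp add: prob_meas_R_def)
  define r where "r = (\<lambda>a x. 1 / (a - complex_of_real x))"
  define Ga Gb where "Ga = cauchy_G \<mu> a" and "Gb = cauchy_G \<mu> b"
  have nz: "Ga \<noteq> 0" "Gb \<noteq> 0" using cauchy_G_nonzero[OF \<mu>] a b by (auto simp: Ga_def Gb_def)
  have ra: "integrable \<mu> (r a)" and rb: "integrable \<mu> (r b)"
    using integrable_resolvent[OF \<mu>] a b by (auto simp: r_def)
  have rb': "integrable \<mu> (\<lambda>x. cnj (r b x))" using rb by simp
  have ab: "a - cnj b \<noteq> 0" using a b by (auto simp: complex_eq_iff)
  have an: "a - complex_of_real x \<noteq> 0" and bn: "cnj b - complex_of_real x \<noteq> 0" for x
    using a b by (auto simp: complex_eq_iff)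
  \<comment> \<open>Resolvent identity at the points a and cnj b.\<close>
  have res: "r a x * cnj (r b x) = (cnj (r b x) - r a x) / (a - cnj b)" for x
    using ab an[of x] bn[of x] by (simp add: r_def divide_simps)
  have int_ab: "integrable \<mu> (\<lambda>x. r a x * cnj (r b x))" unfolding res using ra rb' by simp
  have Ga: "(\<integral>x. r a x \<partial>\<mu>) = Ga" by (simp add: r_def Ga_def cauchy_G_def)
  have Gb: "(\<integral>x. r b x \<partial>\<mu>) = Gb" by (simp add: r_def Gb_def cauchy_G_def)
  have "(\<integral>x. r a x * cnj (r b x) \<partial>\<mu>) = (\<integral>x. (cnj (r b x) - r a x) / (a - cnj b) \<partial>\<mu>)"
    by (simp only: res)
  also have "\<dots> = (cnj Gb - Ga) / (a - cnj b)" using ra rb' by (simp add: Ga Gb)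
  finally have Iab: "(\<integral>x. r a x * cnj (r b x) \<partial>\<mu>) = (cnj Gb - Ga) / (a - cnj b)" .
  have U: "U a x * cnj (U b x) = (r a x * cnj (r b x)) / (Ga * cnj Gb) - r a x / Ga - cnj (r b x) / cnj Gb + 1" for x
  proof -
    have "(s / Ga - 1) * cnj (t / Gb - 1) = (s * cnj t) / (Ga * cnj Gb) - s / Ga - cnj t / cnj Gb + 1" for s t
      by (simp add: algebra_simps diff_divide_distrib)
    then show ?thesis by (simp only: U_def r_def Ga_def Gb_def)
  qed
  show "integrable \<mu> (\<lambda>x. U a x * cnj (U b x))"
    unfolding U using int_ab ra rb' by simp
  have "(\<integral>x. U a x * cnj (U b x) \<partial>\<mu>) = (cnj Gb - Ga) / (a - cnj b) / (Ga * cnj Gb) - Ga / Ga - cnj Gb / cnj Gb + 1"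
    unfolding U using int_ab ra rb' by (simp add: Ga Gb Iab prob_space)
  also have "\<dots> = ((1 / Ga - a) - cnj (1 / Gb - b)) / (a - cnj b)"
    using nz ab by (simp add: field_simps)
  finally show "(\<integral>x. U a x * cnj (U b x) \<partial>\<mu>)
           = ((recip_H \<mu> a - a) - cnj (recip_H \<mu> b - b)) / (a - cnj b)"
    by (simp add: recip_H_def Ga_def Gb_def)
qed

text \<open>Cauchy-Schwarz for the kernel produces distances to conjugate points. Rewriting both of
  them by this identity makes the products of four imaginary parts cancel, which leaves the form
  used in \<open>pick_map\<close>.\<close>

lemma cmod_diff_cnj: "(cmod (w - cnj v))\<^sup>2 = (cmod (w - v))\<^sup>2 + 4 * (Im w * Im v)"
  unfolding cmod_power2 by (simp add: power2_eq_square algebra_simps)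

text \<open>On the diagonal the kernel is Im (H a - a) / Im a, a second moment and hence
  nonnegative. Off the diagonal, Cauchy-Schwarz bounds it by the two diagonal values.\<close>

lemma recip_H_pick_map:
  assumes \<mu>: "prob_meas_R \<mu>"
  shows "pick_map (recip_H \<mu>)"
proof -
  define U where "U = (\<lambda>a x. 1 / (a - complex_of_real x) / cauchy_G \<mu> a - 1)"
  let ?p = "\<lambda>a. recip_H \<mu> a - a"
  have cancel: "(complex_of_real (2 * s) * \<i>) / (complex_of_real (2 * t) * \<i>) = complex_of_real (s / t)" for s t
    by simp
  have cross: "p / q \<le> r / s \<Longrightarrow> 0 < q \<Longrightarrow> 0 < s \<Longrightarrow> p * s \<le> r * q" for p q r s :: real
    by (simp add: divide_simps mult.commute)
  have U2: "complex_of_real ((cmod (U a x))\<^sup>2) = U a x * cnj (U a x)" for a x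
    using complex_norm_square by blast
  have diag: "integrable \<mu> (\<lambda>x. (cmod (U a x))\<^sup>2)" "(\<integral>x. (cmod (U a x))\<^sup>2 \<partial>\<mu>) = Im (?p a) / Im a"
    if a: "0 < Im a" for a
  proof -
    have "integrable \<mu> (\<lambda>x. Re (U a x * cnj (U a x)))"
      using nevanlinna_kernel(1)[OF \<mu> a a] unfolding U_def by (rule integrable_Re)
    then show "integrable \<mu> (\<lambda>x. (cmod (U a x))\<^sup>2)" by (simp only: U2[symmetric] Re_complex_of_real)
    have "complex_of_real (\<integral>x. (cmod (U a x))\<^sup>2 \<partial>\<mu>) = (\<integral>x. U a x * cnj (U a x) \<partial>\<mu>)"
      by (simp only: U2[symmetric] integral_complex_of_real)
    also have "\<dots> = (?p a - cnj (?p a)) / (a - cnj a)"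
      using nevanlinna_kernel(2)[OF \<mu> a a] by (simp only: U_def)
    also have "\<dots> = (complex_of_real (2 * Im (?p a)) * \<i>) / (complex_of_real (2 * Im a) * \<i>)"
      by (simp only: complex_diff_cnj)
    also have "\<dots> = complex_of_real (Im (?p a) / Im a)" by (rule cancel)
    finally show "(\<integral>x. (cmod (U a x))\<^sup>2 \<partial>\<mu>) = Im (?p a) / Im a" by (simp only: of_real_eq_iff)
  qed
  have Im_p: "0 \<le> Im (?p a)" if "0 < Im a" for a
  proof -
    have "0 \<le> Im (?p a) / Im a" unfolding diag(2)[OF that, symmetric] by simp
    then show ?thesis using that by (simp add: zero_le_divide_iff)
  qed
  moreover have "(cmod (?p a - ?p b))\<^sup>2 * (Im a * Im b) \<le> Im (?p a) * Im (?p b) * (cmod (a - b))\<^sup>2"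
    if a: "0 < Im a" and b: "0 < Im b" for a b
  proof -
    have ab: "a - cnj b \<noteq> 0" using a b by (auto simp: complex_eq_iff)
    have n: "integrable \<mu> (\<lambda>x. U a x * cnj (U b x))"
      using nevanlinna_kernel(1)[OF \<mu> a b] by (simp only: U_def)
    have "(cmod (\<integral>x. U a x * cnj (U b x) \<partial>\<mu>))\<^sup>2
        \<le> (\<integral>x. (cmod (U a x))\<^sup>2 \<partial>\<mu>) * (\<integral>x. (cmod (cnj (U b x)))\<^sup>2 \<partial>\<mu>)"
      by (rule cauchy_schwarz_integral[OF diag(1)[OF a] _ n]) (simp only: complex_mod_cnj diag(1)[OF b])
    also have "(\<integral>x. U a x * cnj (U b x) \<partial>\<mu>) = (?p a - cnj (?p b)) / (a - cnj b)"
      using nevanlinna_kernel(2)[OF \<mu> a b] by (simp only: U_def)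
    finally have "(cmod ((?p a - cnj (?p b)) / (a - cnj b)))\<^sup>2 \<le> (Im (?p a) / Im a) * (Im (?p b) / Im b)"
      by (simp only: complex_mod_cnj diag(2)[OF a] diag(2)[OF b])
    then have "(cmod (?p a - cnj (?p b)))\<^sup>2 / (cmod (a - cnj b))\<^sup>2 \<le> (Im (?p a) * Im (?p b)) / (Im a * Im b)"
      by (simp only: norm_divide power_divide times_divide_times_eq)
    moreover have "0 < (cmod (a - cnj b))\<^sup>2" "0 < Im a * Im b" using ab a b by simp_all
    ultimately have "(cmod (?p a - cnj (?p b)))\<^sup>2 * (Im a * Im b) \<le> (Im (?p a) * Im (?p b)) * (cmod (a - cnj b))\<^sup>2"
      by (rule cross)
    then show ?thesis
      unfolding cmod_diff_cnj by (simp only: distrib_left distrib_right mult_ac)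
  qed
  ultimately show ?thesis by (auto simp: pick_map_def)
qed

subsection \<open>Injectivity for infinitely divisible measures\<close>

text \<open>\<open>is_mconv\<close> makes each intermediate power a probability measure, so each
  iterate agrees on the upper half-plane with a reciprocal Cauchy transform. The induction carries
  all m <= k because \<open>root_displacement\<close> asks for every one of these iterates.\<close>

lemma is_mpow_iterates:
  assumes \<mu>: "prob_meas_R \<mu>" and "is_mpow \<mu> k \<rho>"
  shows "prob_meas_R \<rho> \<and> (\<forall>z. 0 < Im z \<longrightarrow> recip_H \<rho> z = (recip_H \<mu> ^^ k) z)
    \<and> (\<forall>m\<le>k. pick_map (recip_H \<mu> ^^ m))"
  using assms(2)
proof induction
  case one
  then show ?case
    using \<mu> recip_H_pick_map[OF \<mu>] pick_map_id by (auto simp: le_Suc_eq)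
next
  case (step k \<rho> \<sigma>)
  have \<sigma>: "prob_meas_R \<sigma>" using step.hyps by (simp add: is_mconv_def)
  have eq: "recip_H \<sigma> z = (recip_H \<mu> ^^ Suc k) z" if "0 < Im z" for z
    using step that by (simp add: is_mconv_def)
  have "pick_map (recip_H \<mu> ^^ Suc k)"
    using recip_H_pick_map[OF \<sigma>] by (rule pick_map_cong) (simp add: eq)
  then show ?case using \<sigma> eq step.IH by (auto simp: le_Suc_eq)
qed

text \<open>The product i y G(i y) is the integral of i y / (i y - x), which is bounded by 1 and
  tends to 1 as y grows; dominated convergence gives H(i y) / (i y) -> 1.\<close>

lemma recip_H_asymp_id:
  assumes \<mu>: "prob_meas_R \<mu>" and "0 < \<epsilon>"
  obtains y where "0 < y" "cmod (recip_H \<mu> (\<i> * complex_of_real y) - \<i> * complex_of_real y) \<le> \<epsilon> * y"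
proof -
  interpret prob_space \<mu> using \<mu> by (simp add: prob_meas_R_def)
  define s where "s = (\<lambda>y x. \<i> * complex_of_real y / (\<i> * complex_of_real y - complex_of_real x))"
  have pw: "((\<lambda>y. s y x) \<longlongrightarrow> 1) at_top" for x
  proof -
    have "((\<lambda>y::real. x / y) \<longlongrightarrow> 0) at_top"
      by (rule tendsto_divide_0[OF tendsto_const filterlim_at_top_imp_at_infinity]) (rule filterlim_ident)
    then have "((\<lambda>y. 1 / (1 + \<i> * complex_of_real (x / y))) \<longlongrightarrow> 1 / (1 + \<i> * complex_of_real 0)) at_top"
      by (intro tendsto_intros) auto
    moreover have "\<forall>\<^sub>F y in at_top. 1 / (1 + \<i> * complex_of_real (x / y)) = s y x"
      using eventually_gt_at_top[of "0::real"]
    proof eventually_elim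
      case (elim y)
      have "\<i> * complex_of_real y - complex_of_real x = \<i> * complex_of_real y * (1 + \<i> * complex_of_real (x / y))"
        using elim by (simp add: algebra_simps)
      then show ?case using elim by (simp add: s_def)
    qed
    ultimately have "((\<lambda>y. s y x) \<longlongrightarrow> 1 / (1 + \<i> * complex_of_real 0)) at_top"
      by (rule Lim_transform_eventually)
    then show ?thesis by simp
  qed
  have bd: "cmod (s y x) \<le> 1" for x y
  proof (cases "y = 0")
    case False
    have "\<bar>y\<bar> \<le> cmod (\<i> * complex_of_real y - complex_of_real x)"
      using abs_Im_le_cmod[of "\<i> * complex_of_real y - complex_of_real x"] by simp
    then show ?thesis using False by (simp add: s_def norm_divide norm_mult divide_le_eq_1)
  qed (simp add: s_def)
  have meas: "s y \<in> borel_measurable \<mu>" for y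
    by (rule borel_measurable_real_measure[OF \<mu>]) (simp add: s_def)
  have "((\<lambda>y. \<integral>x. s y x \<partial>\<mu>) \<longlongrightarrow> (\<integral>x. 1 \<partial>\<mu>)) at_top"
    by (rule integral_dominated_convergence_at_top[where w = "\<lambda>_. 1"]) (use pw bd meas in auto)
  then have "((\<lambda>y. 1 / (\<integral>x. s y x \<partial>\<mu>) - 1) \<longlongrightarrow> 1 / 1 - 1) at_top"
    by (intro tendsto_intros) (auto simp: prob_space)
  then have "\<forall>\<^sub>F y in at_top. cmod (1 / (\<integral>x. s y x \<partial>\<mu>) - 1) < \<epsilon>"
    using \<open>0 < \<epsilon>\<close> by (simp add: tendsto_iff)
  then have "\<forall>\<^sub>F y in at_top. 0 < y \<and> cmod (1 / (\<integral>x. s y x \<partial>\<mu>) - 1) < \<epsilon>"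
    using eventually_gt_at_top[of "0::real"] by eventually_elim simp
  then obtain y where y: "0 < y" "cmod (1 / (\<integral>x. s y x \<partial>\<mu>) - 1) < \<epsilon>"
    using eventually_happens[of _ "at_top :: real filter"] by auto
  let ?z = "\<i> * complex_of_real y"
  have "s y = (\<lambda>x. ?z * (1 / (?z - complex_of_real x)))" by (simp add: s_def)
  then have "(\<integral>x. s y x \<partial>\<mu>) = ?z * cauchy_G \<mu> ?z" by (simp only: cauchy_G_def integral_mult_right_zero)
  moreover have "recip_H \<mu> ?z - ?z = ?z * (1 / (?z * cauchy_G \<mu> ?z) - 1)"
    using y(1) cauchy_G_nonzero[OF \<mu>, of ?z] by (simp add: recip_H_def field_simps)
  ultimately have "cmod (recip_H \<mu> ?z - ?z) = y * cmod (1 / (\<integral>x. s y x \<partial>\<mu>) - 1)"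
    using y(1) by (simp add: norm_mult)
  also have "\<dots> \<le> \<epsilon> * y" using y by simp
  finally show thesis using y(1) that by blast
qed

text \<open>High on the imaginary axis H moves points relatively little, so
  \<open>root_displacement\<close> applies there with constants given by H alone. Harnack carries
  the bound to a, with a factor depending on a and the base point. Thus C is uniform in k and in the
  root.\<close>

lemma root_displacement_bound:
  assumes \<nu>: "prob_meas_R \<nu>" and a: "0 < Im a"
  obtains C where "\<And>k \<mu>. 1 \<le> k \<Longrightarrow> prob_meas_R \<mu> \<Longrightarrow> is_mpow \<mu> k \<nu> \<Longrightarrow>
      real k * cmod (recip_H \<mu> a - a) \<le> C"
proof -
  \<comment> \<open>Why 1/16: by Harnack the second application of H raises the imaginary part by at
    most 3 B, so two applications raise it by at most 4 B <= y / 4, as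
    \<open>root_displacement\<close> requires.\<close>
  obtain y where y: "0 < y"
    and small: "cmod (recip_H \<nu> (\<i> * complex_of_real y) - \<i> * complex_of_real y) \<le> 1 / 16 * y"
    by (rule recip_H_asymp_id[OF \<nu>, of "1 / 16"]) auto
  define z where "z = \<i> * complex_of_real y"
  define H where "H = recip_H \<nu>"
  define B where "B = cmod (H z - z)"
  define R where "R = 4 * B\<^sup>2 / (Im z)\<^sup>2"
  define S where "S = (cmod (z - a))\<^sup>2 / (Im z * Im a)"
  have z: "0 < Im z" "Im z = y" using y by (auto simp: z_def)
  have pH: "pick_map H" unfolding H_def by (rule recip_H_pick_map[OF \<nu>])
  have Hz: "Im z \<le> Im (H z)" using pick_map_Im[OF pH z(1)] .
  have B16: "B \<le> y / 16" using small by (simp add: B_def H_def z_def)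
  have "Im (H (H z) - H z) \<le> (2 + 1) * Im (H z - z)"
  proof (rule pick_map_harnack[OF pH z(1)])
    have "(cmod (z - H z))\<^sup>2 \<le> (y / 16)\<^sup>2"
      using B16 unfolding B_def norm_minus_commute[of z] by (rule power_mono) simp
    also have "\<dots> \<le> y * y" using y by (simp add: power2_eq_square)
    also have "\<dots> \<le> y * Im (H z)" using Hz y z(2) by (intro mult_left_mono) auto
    finally show "(cmod (z - H z))\<^sup>2 \<le> 1 * (Im z * Im (H z))" using z(2) by simp
  qed (use Hz z in linarith)
  moreover have "Im (H z - z) \<le> B" using abs_Im_le_cmod[of "H z - z"] by (simp add: B_def)
  ultimately have HH: "Im (H (H z)) - Im z \<le> Im z / 4" using B16 z(2) by simp
  have "real k * cmod (recip_H \<mu> a - a) \<le> (B + (2 + R)\<^sup>2 * B) + (2 + S) * ((2 + R) * B)"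
    if k: "1 \<le> k" and \<mu>: "prob_meas_R \<mu>" and pow: "is_mpow \<mu> k \<nu>" for k \<mu>
  proof -
    let ?f = "recip_H \<mu>"
    have it: "\<And>z. 0 < Im z \<Longrightarrow> (?f ^^ k) z = H z" and P: "\<And>m. m \<le> k \<Longrightarrow> pick_map (?f ^^ m)"
      using is_mpow_iterates[OF \<mu> pow] by (auto simp: H_def)
    have f: "pick_map ?f" by (rule recip_H_pick_map[OF \<mu>])
    have "0 < Im (H z)" using Hz z by linarith
    then have two: "(?f ^^ (2 * k)) z = H (H z)"
      using it z by (simp add: mult_2 funpow_add)
    have th: "Im ((?f ^^ (2 * k)) z) - Im z \<le> Im z / 4" using HH two by simp
    have B': "B = cmod ((?f ^^ k) z - z)" using it z by (simp add: B_def)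
    note D = root_displacement[OF P k z(1) th B' R_def]
    have "cmod ((?f z - z) - (?f a - a)) \<le> (2 + S) * Im (?f z - z)"
      by (rule pick_map_harnack[OF f z(1) a]) (use z a in \<open>simp add: S_def\<close>)
    then have "cmod (?f a - a) \<le> cmod (?f z - z) + (2 + S) * Im (?f z - z)"
      using norm_triangle_ineq3[of "?f z - z" "?f a - a"] by linarith
    then have "real k * cmod (?f a - a) \<le> real k * (cmod (?f z - z) + (2 + S) * Im (?f z - z))"
      by (rule mult_left_mono) simp
    also have "\<dots> = real k * cmod (?f z - z) + (2 + S) * (real k * Im (?f z - z))"
      by (simp only: distrib_left mult.left_commute)
    also have "\<dots> \<le> (B + (2 + R)\<^sup>2 * B) + (2 + S) * ((2 + R) * B)"
      using D z a by (intro add_mono mult_left_mono) (auto simp: S_def)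
    finally show ?thesis .
  qed
  then show thesis by (rule that)
qed

text \<open>The growth of the imaginary part up to time k limits how much a step can exceed the
  first one; \<open>small\<close> keeps every step below Im a. This is the condition under which two
  orbits cannot merge.\<close>

lemma orbit_step_small:
  assumes f: "pick_map f" and a: "0 < Im a" and "j < k"
    and small: "cmod (f a - a) * Im ((f ^^ k) a) < (Im a)\<^sup>2"
  shows "Im (f ((f ^^ j) a) - (f ^^ j) a) < Im ((f ^^ j) a)"
proof -
  let ?w = "(f ^^ j) a"
  have "(cmod (f ?w - ?w) * Im a)\<^sup>2 \<le> (cmod (f a - a) * Im ((f ^^ Suc j) a))\<^sup>2"
    using funpow_pick_map_step[OF f a, of j] by (simp add: power_mult_distrib)
  then have "cmod (f ?w - ?w) * Im a \<le> cmod (f a - a) * Im ((f ^^ Suc j) a)"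
    by (rule power2_le_imp_le) (use funpow_pick_map_Im_pos[OF f a, of "Suc j"] in auto)
  also have "\<dots> \<le> cmod (f a - a) * Im ((f ^^ k) a)"
    using funpow_pick_map_Im_mono[OF f a, of "Suc j" k] \<open>j < k\<close> by (intro mult_left_mono) auto
  also have "\<dots> < Im a * Im a" using small by (simp add: power2_eq_square)
  finally have "cmod (f ?w - ?w) < Im a" using a by (rule mult_right_less_imp_less[OF _ less_imp_le])
  moreover have "Im a \<le> Im ?w" using funpow_pick_map_Im_mono[OF f a, of 0 j] by simp
  ultimately show ?thesis using abs_Im_le_cmod[of "f ?w - ?w"] by linarith
qed

lemma recip_H_inj:
  assumes \<nu>: "prob_meas_R \<nu>" "mono_inf_div \<nu>" and a: "0 < Im a" and b: "0 < Im b"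
    and eq: "recip_H \<nu> a = recip_H \<nu> b"
  shows "a = b"
proof (rule ccontr)
  assume "a \<noteq> b"
  obtain Ca where Ca: "\<And>k \<mu>. 1 \<le> k \<Longrightarrow> prob_meas_R \<mu> \<Longrightarrow> is_mpow \<mu> k \<nu> \<Longrightarrow>
      real k * cmod (recip_H \<mu> a - a) \<le> Ca" by (rule root_displacement_bound[OF \<nu>(1) a]) blast
  obtain Cb where Cb: "\<And>k \<mu>. 1 \<le> k \<Longrightarrow> prob_meas_R \<mu> \<Longrightarrow> is_mpow \<mu> k \<nu> \<Longrightarrow>
      real k * cmod (recip_H \<mu> b - b) \<le> Cb" by (rule root_displacement_bound[OF \<nu>(1) b]) blast
  define Y where "Y = Im (recip_H \<nu> a)"
  have Y: "0 < Y" using pick_map_Im[OF recip_H_pick_map[OF \<nu>(1)] a] a by (simp add: Y_def)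
  \<comment> \<open>Both orbits end at the same point, of imaginary part Y, and their first steps
    are at most C / k; this k makes C Y / k smaller than the squared imaginary part of each starting
    point.\<close>
  obtain k :: nat where k: "max 1 (max (Ca * Y / (Im a)\<^sup>2) (Cb * Y / (Im b)\<^sup>2)) < real k"
    using reals_Archimedean2 by blast
  then have k1: "1 \<le> k" by simp
  obtain \<mu> where \<mu>: "prob_meas_R \<mu>" "is_mpow \<mu> k \<nu>"
    using \<nu>(2) k1 by (auto simp: mono_inf_div_def)
  define f where "f = recip_H \<mu>"
  have f: "pick_map f" unfolding f_def by (rule recip_H_pick_map[OF \<mu>(1)])
  have it: "\<And>z. 0 < Im z \<Longrightarrow> (f ^^ k) z = recip_H \<nu> z"
    using is_mpow_iterates[OF \<mu>] by (simp add: f_def)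
  have key: "cmod (f c - c) * Im ((f ^^ k) c) < (Im c)\<^sup>2"
    if "0 < Im c" "recip_H \<nu> c = recip_H \<nu> a" "real k * cmod (f c - c) \<le> C" "C * Y / (Im c)\<^sup>2 < real k" for c C
  proof -
    have "real k * (cmod (f c - c) * Y) \<le> C * Y"
      using mult_right_mono[OF that(3), of Y] Y by (simp add: mult.assoc)
    also have "\<dots> < real k * (Im c)\<^sup>2" using that(1,4) by (simp add: divide_less_eq)
    finally have "cmod (f c - c) * Y < (Im c)\<^sup>2" using k1 by simp
    then show ?thesis using it[OF that(1)] that(2) by (simp add: Y_def)
  qed
  have Ka: "cmod (f a - a) * Im ((f ^^ k) a) < (Im a)\<^sup>2"
    by (rule key[of a Ca]) (use a k Ca[OF k1 \<mu>] in \<open>auto simp: f_def\<close>)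
  have Kb: "cmod (f b - b) * Im ((f ^^ k) b) < (Im b)\<^sup>2"
    by (rule key[of b Cb]) (use b k eq Cb[OF k1 \<mu>] in \<open>auto simp: f_def\<close>)
  have merged: "(f ^^ k) a = (f ^^ k) b" using it a b eq by simp
  \<comment> \<open>The first time at which the two orbits coincide; just before it, f sends two
    distinct points to one.\<close>
  define n where "n = (LEAST n. (f ^^ n) a = (f ^^ n) b)"
  have n: "(f ^^ n) a = (f ^^ n) b" unfolding n_def using merged by (rule LeastI)
  have "n \<le> k" unfolding n_def using merged by (rule Least_le)
  have "n \<noteq> 0" using n \<open>a \<noteq> b\<close> by (intro notI) simp
  then obtain j where j: "n = Suc j" by (cases n) auto
  let ?u = "(f ^^ j) a" and ?v = "(f ^^ j) b"
  have "?u \<noteq> ?v" using not_less_Least[of j "\<lambda>n. (f ^^ n) a = (f ^^ n) b"] j by (simp add: n_def)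
  have "j < k" using \<open>n \<le> k\<close> j by simp
  have fuv: "f ?u = f ?v" using n j by simp
  have pos: "0 < Im ?u" "0 < Im ?v" using funpow_pick_map_Im_pos[OF f] a b by auto
  \<comment> \<open>Since f u = f v, the displacements differ by exactly v - u, so the factor |u -
    v|^2 occurs on both sides and cancels.\<close>
  have "(cmod (?u - ?v))\<^sup>2 * (Im ?u * Im ?v) \<le> Im (f ?u - ?u) * Im (f ?v - ?v) * (cmod (?u - ?v))\<^sup>2"
    using pick_map_dist[OF f pos] fuv by (simp add: norm_minus_commute)
  then have "Im ?u * Im ?v \<le> Im (f ?u - ?u) * Im (f ?v - ?v)"
    using \<open>?u \<noteq> ?v\<close> by (simp add: mult.commute[of "(cmod (?u - ?v))\<^sup>2"])
  moreover have "Im (f ?u - ?u) * Im (f ?v - ?v) < Im ?u * Im ?v"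
    by (rule mult_strict_mono'[OF orbit_step_small[OF f a \<open>j < k\<close> Ka] orbit_step_small[OF f b \<open>j < k\<close> Kb]])
      (use pick_map_Im[OF f] pos in auto)
  ultimately show False by linarith
qed

subsection \<open>The neighbourhood of an isolated atom\<close>

text \<open>Each point off the support has a null ball around it, and by Lindelof countably many
  such balls cover U.\<close>

lemma emeasure_off_supp:
  assumes sets: "sets \<mu> = sets borel" and "open U" and U: "U \<inter> supp_meas \<mu> = {}"
  shows "emeasure \<mu> U = 0"
proof -
  define F where "F = {ball x e | x e. emeasure \<mu> (ball x e) = 0}"
  have "\<And>S. S \<in> F \<Longrightarrow> open S" by (auto simp: F_def)
  then obtain F' where F': "F' \<subseteq> F" "countable F'" "\<Union>F' = \<Union>F" by (rule Lindelof)
  have "U \<subseteq> \<Union>F"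
  proof
    fix x assume "x \<in> U"
    then have "x \<notin> supp_meas \<mu>" using U by auto
    then obtain e where e: "e > 0" "\<not> 0 < emeasure \<mu> (ball x e)" unfolding supp_meas_def by blast
    then have "emeasure \<mu> (ball x e) = 0" by simp
    then have "ball x e \<in> F" unfolding F_def by blast
    moreover have "x \<in> ball x e" using e(1) by simp
    ultimately show "x \<in> \<Union>F" by blast
  qed
  moreover have "(\<Union>S\<in>F'. S) \<in> null_sets \<mu>"
  proof (rule null_sets_UN')
    fix S assume "S \<in> F'"
    then have "S \<in> F" using F'(1) by blast
    then obtain x e where "S = ball x e" "emeasure \<mu> (ball x e) = 0" unfolding F_def by blast
    then show "S \<in> null_sets \<mu>" by (simp add: null_sets_def sets)
  qed (rule F'(2))
  then have "\<Union>F' \<in> null_sets \<mu>" by simp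
  ultimately have "U \<in> null_sets \<mu>"
    using \<open>open U\<close> unfolding F'(3) by (auto intro: null_sets_subset[of "\<Union>F"] simp: sets)
  then show ?thesis by (rule null_setsD1)
qed

text \<open>A bounded Lebesgue null set is covered by countably many nonoverlapping intervals of
  total length at most e, so its M-measure is at most C e.\<close>

lemma absolutely_continuous_lipschitz:
  fixes M :: "real measure"
  assumes sets: "sets M = sets borel" and C: "0 \<le> C"
    and lip: "\<And>c d. c < d \<Longrightarrow> emeasure M {c..d} \<le> ennreal (C * (d - c))"
  shows "absolutely_continuous lborel M"
proof -
  have bdd: "emeasure M S = 0" if S: "S \<in> null_sets lborel" "S \<subseteq> cbox a b" and "a < b" for S :: "real set" and a b
  proof -
    have le: "emeasure M S \<le> ennreal C * ennreal e" if "0 < e" for e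
    proof -
      have S': "S \<in> null_sets lebesgue" using S(1) by (rule null_sets_completionI)
      then have S0: "S \<in> lmeasurable" "measure lebesgue S = 0"
        by (auto simp: fmeasurable_def null_sets_def measure_def)
      obtain \<D> where \<D>: "countable \<D>"
        "\<And>K. K \<in> \<D> \<Longrightarrow> K \<subseteq> cbox a b \<and> K \<noteq> {} \<and> (\<exists>c d. K = cbox c d)"
        "pairwise (\<lambda>A B. interior A \<inter> interior B = {}) \<D>"
        "\<And>u v. cbox u v \<in> \<D> \<Longrightarrow> \<exists>n. \<forall>i \<in> Basis. v \<bullet> i - u \<bullet> i = (b \<bullet> i - a \<bullet> i)/2^n"
        "\<And>K. \<lbrakk>K \<in> \<D>; box a b \<noteq> {}\<rbrakk> \<Longrightarrow> interior K \<noteq> {}"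
        "S \<subseteq> \<Union>\<D>" "\<Union>\<D> \<in> lmeasurable" "measure lebesgue (\<Union>\<D>) \<le> measure lebesgue S + e"
        by (rule measurable_outer_intervals_bounded[OF S0(1) S(2) \<open>0 < e\<close>]) blast
      have box: "\<exists>c d. K = {c..d} \<and> c < d" if K: "K \<in> \<D>" for K
      proof -
        obtain c d where "K = {c..d}" using \<D>(2)[OF K] by auto
        moreover have "interior K \<noteq> {}" using \<D>(5)[OF K] \<open>a < b\<close> by simp
        ultimately show ?thesis by auto
      qed
      have meas: "K \<in> sets M" if "K \<in> \<D>" for K using box[OF that] by (auto simp: sets)
      have UM: "\<Union>\<D> \<in> sets M" using meas \<D>(1) by (intro sets.countable_Union) auto
      have "emeasure M S \<le> emeasure M (\<Union>\<D>)" using \<D>(6) UM by (rule emeasure_mono)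
      also have "\<dots> = (\<integral>\<^sup>+x. indicator (\<Union>\<D>) x \<partial>M)" using UM by simp
      \<comment> \<open>The intervals may share endpoints, so M is only countably subadditive on
        them: each point is counted with multiplicity.\<close>
      also have "\<dots> \<le> (\<integral>\<^sup>+x. \<integral>\<^sup>+K. indicator K x \<partial>count_space \<D> \<partial>M)"
      proof (rule nn_integral_mono)
        fix x
        show "indicator (\<Union>\<D>) x \<le> (\<integral>\<^sup>+K. indicator K x \<partial>count_space \<D>)"
        proof (cases "x \<in> \<Union>\<D>")
          case True
          then obtain K where K: "K \<in> \<D>" "x \<in> K" by auto
          have "1 = (\<integral>\<^sup>+L. indicator {K} L \<partial>count_space \<D>)"
            using K by (subst nn_integral_indicator) auto
          also have "\<dots> \<le> (\<integral>\<^sup>+L. indicator L x \<partial>count_space \<D>)"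
            using K by (intro nn_integral_mono) (auto split: split_indicator)
          finally show ?thesis using True by simp
        qed simp
      qed
      also have "\<dots> = (\<integral>\<^sup>+K. emeasure M K \<partial>count_space \<D>)"
        using meas \<D>(1) by (subst nn_integral_count_space_nn_integral) (auto intro!: nn_integral_cong)
      \<comment> \<open>An interval and its interior have the same length, and the interiors are
        disjoint, so the lengths add up exactly.\<close>
      also have "\<dots> \<le> (\<integral>\<^sup>+K. ennreal C * emeasure lborel (interior K) \<partial>count_space \<D>)"
      proof (rule nn_integral_mono)
        fix K assume "K \<in> space (count_space \<D>)"
        then obtain c d where K: "K = {c..d}" "c < d" using box[of K] by auto
        then show "emeasure M K \<le> ennreal C * emeasure lborel (interior K)"
          using lip[of c d] C by (simp add: ennreal_mult)
      qed
      also have "\<dots> = ennreal C * (\<integral>\<^sup>+K. emeasure lborel (interior K) \<partial>count_space \<D>)"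
        by (rule nn_integral_cmult) simp
      also have "(\<integral>\<^sup>+K. emeasure lborel (interior K) \<partial>count_space \<D>) = emeasure lborel (\<Union>K\<in>\<D>. interior K)"
        using \<D>(1,3) by (subst emeasure_UN_countable) (auto simp: disjoint_family_on_def pairwise_def)
      also have "\<dots> = emeasure lebesgue (\<Union>K\<in>\<D>. interior K)"
      proof -
        have "open (\<Union>K\<in>\<D>. interior K)" by (intro open_UN) simp
        then have "(\<Union>K\<in>\<D>. interior K) \<in> sets lborel" by simp
        then show ?thesis by (simp only: emeasure_completion[OF sets_completionI_sets] main_part)
      qed
      also have "\<dots> \<le> emeasure lebesgue (\<Union>\<D>)"
        using \<D>(7) interior_subset by (intro emeasure_mono) (auto simp: fmeasurable_def)
      also have "\<dots> = ennreal (measure lebesgue (\<Union>\<D>))" using \<D>(7) by (rule emeasure_eq_measure2)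
      also have "\<dots> \<le> ennreal e" using \<D>(8) S0(2) by (intro ennreal_leI) simp
      finally show ?thesis by (simp add: mult_left_mono)
    qed
    have "emeasure M S \<le> 0"
    proof (rule ennreal_le_epsilon)
      fix e :: real assume "0 < e"
      have "emeasure M S \<le> ennreal C * ennreal (e / (C + 1))" using C \<open>0 < e\<close> by (intro le) simp
      also have "\<dots> = ennreal (C * (e / (C + 1)))"
        using C \<open>0 < e\<close> by (intro ennreal_mult[symmetric]) auto
      also have "\<dots> \<le> ennreal e" using C \<open>0 < e\<close> by (intro ennreal_leI) (simp add: divide_simps)
      finally show "emeasure M S \<le> 0 + ennreal e" by simp
    qed
    then show ?thesis by simp
  qed
  show ?thesis
    unfolding absolutely_continuous_def
  proof
    fix N :: "real set" assume N: "N \<in> null_sets lborel"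
    \<comment> \<open>The shift by 1 keeps the box nondegenerate at n = 0, as \<open>bdd\<close>
      demands.\<close>
    have "(\<Union>n::nat. N \<inter> cbox (- real n - 1) (real n + 1)) \<in> null_sets M"
    proof (rule null_sets_UN')
      fix n :: nat
      have "N \<inter> cbox (- real n - 1) (real n + 1) \<in> null_sets lborel"
        using N by (intro null_set_Int2) auto
      then show "N \<inter> cbox (- real n - 1) (real n + 1) \<in> null_sets M"
        using bdd[of _ "- real n - 1" "real n + 1"] by (auto simp: null_sets_def sets)
    qed simp
    moreover have "(\<Union>n::nat. N \<inter> cbox (- real n - 1) (real n + 1)) = N"
    proof (intro equalityI subsetI)
      fix x assume "x \<in> N"
      obtain n :: nat where "\<bar>x\<bar> < real n" using reals_Archimedean2 by blast
      then have "x \<in> cbox (- real n - 1) (real n + 1)" by auto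
      then show "x \<in> (\<Union>n::nat. N \<inter> cbox (- real n - 1) (real n + 1))" using \<open>x \<in> N\<close> by blast
    qed auto
    ultimately show "N \<in> null_sets M" by simp
  qed
qed

text \<open>The Poisson kernel v / ((u - x)^2 + v^2) is at least 1 / (2 v) for |x - u| <= v, and its
  integral is -Im G(u + i v).\<close>

lemma measure_interval_le_cauchy_G:
  assumes \<mu>: "prob_meas_R \<mu>" and v: "0 < v"
  shows "measure \<mu> {u - v..u + v} \<le> 2 * v * cmod (cauchy_G \<mu> (complex_of_real u + \<i> * complex_of_real v))"
proof -
  interpret prob_space \<mu> using \<mu> by (simp add: prob_meas_R_def)
  define z where "z = complex_of_real u + \<i> * complex_of_real v"
  have z: "0 < Im z" "Im z = v" using v by (auto simp: z_def)
  have sets: "{u - v..u + v} \<in> events" using \<mu> by (simp add: prob_meas_R_def)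
  have space: "space \<mu> = UNIV" using \<mu> sets_eq_imp_space_eq[of \<mu> borel] by (simp add: prob_meas_R_def)
  have le: "indicator {u - v..u + v} x \<le> 2 * v * (Im z / (cmod (z - complex_of_real x))\<^sup>2)" for x
  proof (cases "x \<in> {u - v..u + v}")
    case True
    have d: "(cmod (z - complex_of_real x))\<^sup>2 = (u - x)\<^sup>2 + v\<^sup>2" by (simp add: cmod_power2 z_def)
    have "\<bar>u - x\<bar> \<le> v" using True by auto
    then have "(u - x)\<^sup>2 \<le> v\<^sup>2" using power_mono[of "\<bar>u - x\<bar>" v 2] by simp
    moreover have "0 < (u - x)\<^sup>2 + v\<^sup>2" using v by (simp add: add_nonneg_pos)
    ultimately have "1 \<le> 2 * v * (v / ((u - x)\<^sup>2 + v\<^sup>2))" by (simp add: pos_le_divide_eq power2_eq_square)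
    then show ?thesis using True z d by simp
  qed (use v z in simp)
  have "measure \<mu> {u - v..u + v} = (\<integral>x. indicator {u - v..u + v} x \<partial>\<mu>)"
    by (simp add: space)
  also have "\<dots> \<le> (\<integral>x. 2 * v * (Im z / (cmod (z - complex_of_real x))\<^sup>2) \<partial>\<mu>)"
  proof (rule integral_mono)
    show "integrable \<mu> (\<lambda>x. indicator {u - v..u + v} x :: real)"
      using sets by (simp add: emeasure_eq_measure)
    show "integrable \<mu> (\<lambda>x. 2 * v * (Im z / (cmod (z - complex_of_real x))\<^sup>2))"
      using integrable_poisson_kernel[OF \<mu> z(1)] by (rule integrable_mult_right)
  qed (rule le)
  also have "\<dots> = 2 * v * (- Im (cauchy_G \<mu> z))"
    using Im_cauchy_G[OF \<mu> z(1)] by (simp only: integral_mult_right_zero)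
  also have "\<dots> \<le> 2 * v * cmod (cauchy_G \<mu> z)"
    using abs_Im_le_cmod[of "cauchy_G \<mu> z"] v by (intro mult_left_mono) auto
  finally show ?thesis by (simp add: z_def)
qed

text \<open>With $G(z) = m/(z-a) + g(z)$, the equation $H(\zeta) = w$ reads $\zeta = a + w (m + (\zeta - a) g(\zeta))$,
  a contraction near $a$ for small $w$.\<close>
lemma atom_preimage:
  fixes a r :: real
  assumes \<mu>: "prob_meas_R \<mu>" and r: "0 < r" and gap: "emeasure \<mu> (ball a r - {a}) = 0"
    and atom: "0 < measure \<mu> {a}" and w: "0 < Im w" "cmod w \<le> r / 8"
  obtains \<zeta> where "\<zeta> \<in> cball (complex_of_real a) (r / 2)" "0 < Im \<zeta>" "recip_H \<mu> \<zeta> = w"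
proof -
  interpret prob_space \<mu> using \<mu> by (simp add: prob_meas_R_def)
  define m where "m = measure \<mu> {a}"
  \<comment> \<open>Dropping the ball from the integrand makes g meaningful on both sides of the
    real axis near a: it continues the regular part of G across the gap.\<close>
  define q where "q = (\<lambda>z x. indicator (- ball a r) x / (z - complex_of_real x))"
  define g where "g = (\<lambda>z. \<integral>x. q z x \<partial>\<mu>)"
  define B where "B = cball (complex_of_real a) (r / 2)"
  have sets: "sets \<mu> = sets borel" using \<mu> by (simp add: prob_meas_R_def)
  have m: "0 < m" "m \<le> 1" using atom by (auto simp: m_def)
  have far: "r / 2 \<le> cmod (z - complex_of_real x)" if "z \<in> B" "x \<in> - ball a r" for z x
  proof -
    have "r \<le> cmod (complex_of_real a - complex_of_real x)"
      using that(2) by (simp add: dist_real_def flip: of_real_diff)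
    also have "\<dots> \<le> cmod (complex_of_real a - z) + cmod (z - complex_of_real x)"
      using norm_triangle_ineq[of "complex_of_real a - z" "z - complex_of_real x"] by simp
    finally show ?thesis using that(1) by (simp add: B_def dist_norm)
  qed
  have q_bd: "cmod (q z x) \<le> 2 / r" if "z \<in> B" for z x
  proof (cases "x \<in> - ball a r")
    case True
    show ?thesis using far[OF that True] r True
      by (simp add: q_def norm_divide frac_le[of 1 1 "r / 2", simplified])
  qed (use r in \<open>simp add: q_def\<close>)
  have q_meas: "q z \<in> borel_measurable borel" for z unfolding q_def by measurable
  have q_int: "integrable \<mu> (q z)" if "z \<in> B" for z
    using integrable_bounded_real_measure[OF \<mu> q_meas q_bd[OF that]] .
  have q_lip: "cmod (q z x - q z' x) \<le> 4 / r\<^sup>2 * cmod (z - z')" if "z \<in> B" "z' \<in> B" for z z' x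
  proof (cases "x \<in> - ball a r")
    case True
    let ?d = "z - complex_of_real x" and ?d' = "z' - complex_of_real x"
    have nz: "?d \<noteq> 0" "?d' \<noteq> 0" using far[OF that(1) True] far[OF that(2) True] r by auto
    have "q z x - q z' x = (z' - z) * (q z x * q z' x)"
      using True nz by (simp add: q_def divide_simps)
    then have "cmod (q z x - q z' x) = cmod (z - z') * (cmod (q z x) * cmod (q z' x))"
      by (simp add: norm_mult norm_minus_commute)
    also have "\<dots> \<le> cmod (z - z') * ((2 / r) * (2 / r))"
      using q_bd that r by (intro mult_left_mono mult_mono) auto
    finally show ?thesis by (simp add: power2_eq_square mult.commute)
  qed (simp add: q_def)
  have g_bd: "cmod (g z) \<le> 2 / r" if "z \<in> B" for z
  proof -
    have "cmod (g z) \<le> (\<integral>x. cmod (q z x) \<partial>\<mu>)" unfolding g_def by (rule integral_norm_bound)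
    also have "\<dots> \<le> (\<integral>x. 2 / r \<partial>\<mu>)" using q_int[OF that] q_bd[OF that] by (intro integral_mono) auto
    finally show ?thesis by (simp add: prob_space)
  qed
  have g_lip: "cmod (g z - g z') \<le> 4 / r\<^sup>2 * cmod (z - z')" if "z \<in> B" "z' \<in> B" for z z'
  proof -
    have "g z - g z' = (\<integral>x. q z x - q z' x \<partial>\<mu>)" using q_int that by (simp add: g_def)
    then have "cmod (g z - g z') \<le> (\<integral>x. cmod (q z x - q z' x) \<partial>\<mu>)" by (simp only: integral_norm_bound)
    also have "\<dots> \<le> (\<integral>x. 4 / r\<^sup>2 * cmod (z - z') \<partial>\<mu>)"
      using q_int that q_lip[OF that] by (intro integral_mono) auto
    finally show ?thesis by (simp add: prob_space)
  qed
  have g_cnj: "g (cnj z) = cnj (g z)" if "z \<in> B" for z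
  proof -
    have "q (cnj z) = (\<lambda>x. cnj (q z x))" by (auto simp: q_def split: split_indicator)
    then show ?thesis using integral_bounded_linear[OF bounded_linear_cnj q_int[OF that]] by (simp add: g_def)
  qed
  have G: "cauchy_G \<mu> z = m / (z - complex_of_real a) + g z" if "z \<in> B" "0 < Im z" for z
  proof -
    have "AE x in \<mu>. x \<notin> ball a r - {a}"
      using gap by (intro AE_not_in) (auto simp: null_sets_def sets)
    then have ae: "AE x in \<mu>. 1 / (z - complex_of_real x) = indicator {a} x *\<^sub>R (1 / (z - complex_of_real a)) + q z x"
      by eventually_elim (use r in \<open>auto simp: q_def split: split_indicator\<close>)
    have "cauchy_G \<mu> z = (\<integral>x. indicator {a} x *\<^sub>R (1 / (z - complex_of_real a)) + q z x \<partial>\<mu>)"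
      unfolding cauchy_G_def
    proof (rule integral_cong_AE)
      show "(\<lambda>x. 1 / (z - complex_of_real x)) \<in> borel_measurable \<mu>"
        using integrable_resolvent[OF \<mu> that(2)] by simp
      show "(\<lambda>x. indicator {a} x *\<^sub>R (1 / (z - complex_of_real a)) + q z x) \<in> borel_measurable \<mu>"
        by (rule borel_measurable_real_measure[OF \<mu>]) (use q_meas in measurable)
    qed (rule ae)
    also have "\<dots> = (\<integral>x. indicator {a} x *\<^sub>R (1 / (z - complex_of_real a)) \<partial>\<mu>) + g z"
      unfolding g_def using q_int[OF that(1)]
      by (intro Bochner_Integration.integral_add integrable_scaleR_left) (auto simp: sets emeasure_eq_measure)
    also have "(\<integral>x. indicator {a} x *\<^sub>R (1 / (z - complex_of_real a)) \<partial>\<mu>) = m / (z - complex_of_real a)"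
      by (simp add: m_def sets scaleR_conv_of_real emeasure_eq_measure)
    finally show ?thesis .
  qed
  define T where "T = (\<lambda>z. complex_of_real a + w * (m + (z - complex_of_real a) * g z))"
  have "\<exists>!z\<in>B. T z = z"
  \<comment> \<open>On B, |m + (z - a) g(z)| <= 1 + (r/2)(2/r) = 2, so |w| <= r/8 keeps T(z) within
    r/4 of a. The Lipschitz constant is r/8 times 2/r + (r/2)(4/r^2), that is 1/2.\<close>
  proof (rule Banach_fix[where c = "1 / 2", OF compact_imp_complete])
    show "compact B" "B \<noteq> {}" using r by (auto simp: B_def)
    show "T ` B \<subseteq> B"
    proof
      fix y assume "y \<in> T ` B"
      then obtain z where z: "z \<in> B" "y = T z" by blast
      have zd: "cmod (z - complex_of_real a) \<le> r / 2" using z(1) by (simp add: B_def dist_norm norm_minus_commute)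
      have "cmod (m + (z - complex_of_real a) * g z) \<le> cmod (of_real m) + cmod ((z - complex_of_real a) * g z)"
        by (rule norm_triangle_ineq)
      also have "\<dots> \<le> 1 + r / 2 * (2 / r)"
        unfolding norm_mult using m zd g_bd[OF z(1)] r by (intro add_mono mult_mono) auto
      finally have "cmod (m + (z - complex_of_real a) * g z) \<le> 2" using r by simp
      then have "cmod w * cmod (m + (z - complex_of_real a) * g z) \<le> r / 8 * 2"
        using w r by (intro mult_mono) auto
      then have "cmod (T z - complex_of_real a) \<le> r / 2" using r by (simp add: T_def norm_mult)
      then show "y \<in> B" using z(2) by (simp add: B_def dist_norm norm_minus_commute)
    qed
    fix x y assume xy: "x \<in> B" "y \<in> B"
    have yd: "cmod (y - complex_of_real a) \<le> r / 2" using xy(2) by (simp add: B_def dist_norm norm_minus_commute)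
    have "T x - T y = w * ((x - y) * g x + (y - complex_of_real a) * (g x - g y))"
      by (simp add: T_def algebra_simps)
    then have "cmod (T x - T y) = cmod w * cmod ((x - y) * g x + (y - complex_of_real a) * (g x - g y))"
      by (simp add: norm_mult)
    also have "\<dots> \<le> r / 8 * (cmod (x - y) * (2 / r) + r / 2 * (4 / r\<^sup>2 * cmod (x - y)))"
    proof (rule mult_mono)
      have "cmod ((x - y) * g x + (y - complex_of_real a) * (g x - g y))
          \<le> cmod (x - y) * cmod (g x) + cmod (y - complex_of_real a) * cmod (g x - g y)"
        using norm_triangle_ineq[of "(x - y) * g x" "(y - complex_of_real a) * (g x - g y)"] by (simp add: norm_mult)
      also have "\<dots> \<le> cmod (x - y) * (2 / r) + r / 2 * (4 / r\<^sup>2 * cmod (x - y))"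
        using g_bd[OF xy(1)] g_lip[OF xy] yd r by (intro add_mono mult_mono) auto
      finally show "cmod ((x - y) * g x + (y - complex_of_real a) * (g x - g y))
          \<le> cmod (x - y) * (2 / r) + r / 2 * (4 / r\<^sup>2 * cmod (x - y))" .
    qed (use w r in auto)
    also have "\<dots> = 1 / 2 * cmod (x - y)" using r by (simp add: power2_eq_square field_simps)
    finally show "dist (T x) (T y) \<le> 1 / 2 * dist x y" by (simp add: dist_norm)
  qed auto
  then obtain \<zeta> where \<zeta>: "\<zeta> \<in> B" "T \<zeta> = \<zeta>" by blast
  have w0: "w \<noteq> 0" using w by auto
  have "\<zeta> \<noteq> complex_of_real a"
  proof
    assume "\<zeta> = complex_of_real a"
    then have "w * m = 0" using \<zeta>(2) by (simp add: T_def)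
    then show False using w0 m by simp
  qed
  then have sz: "\<zeta> - complex_of_real a \<noteq> 0" by simp
  have "\<zeta> - complex_of_real a = w * (m + (\<zeta> - complex_of_real a) * g \<zeta>)"
    using \<zeta>(2) by (simp add: T_def algebra_simps)
  then have inv: "1 / w = m / (\<zeta> - complex_of_real a) + g \<zeta>"
    using sz w0 by (simp add: field_simps)
  have Im_inv: "Im (1 / w) < 0" using w by (simp add: Im_divide divide_neg_pos add_nonneg_pos)
  have conj: "cnj (1 / w) = m / (cnj \<zeta> - complex_of_real a) + g (cnj \<zeta>)"
    unfolding inv using g_cnj[OF \<zeta>(1)] by simp
  have Bc: "cnj \<zeta> \<in> B"
  proof -
    have "complex_of_real a - cnj \<zeta> = cnj (complex_of_real a - \<zeta>)" by simp
    then show ?thesis using \<zeta>(1) by (simp only: B_def mem_cball dist_norm complex_mod_cnj)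
  qed
  \<comment> \<open>In the lower half-plane, reflection would give \<open>1 / w\<close> the wrong sign of the imaginary part.\<close>
  have "0 < Im \<zeta>"
  proof (rule ccontr)
    assume "\<not> 0 < Im \<zeta>"
    then consider "Im \<zeta> = 0" | "0 < Im (cnj \<zeta>)" by fastforce
    then show False
    proof cases
      case 1
      then have "cnj \<zeta> = \<zeta>" by (simp add: complex_eq_iff)
      then have "cnj (1 / w) = 1 / w" using conj inv by simp
      then have "- Im (1 / w) = Im (1 / w)" by (metis cnj.sel(2))
      then show False using Im_inv by simp
    next
      case 2
      have "cauchy_G \<mu> (cnj \<zeta>) = cnj (1 / w)" using G[OF Bc 2] conj by simp
      then have "- Im (1 / w) < 0" using Im_cauchy_G_neg[OF \<mu> 2] by (simp only: cnj.sel)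
      then show False using Im_inv by simp
    qed
  qed
  moreover have "recip_H \<mu> \<zeta> = w"
    using w0 unfolding recip_H_def G[OF \<zeta>(1) \<open>0 < Im \<zeta>\<close>] inv[symmetric] by simp
  ultimately show thesis using \<zeta>(1) that by (simp add: B_def)
qed

text \<open>A value |G(z)| >= 8/r means |H(z)| <= r/8, and such a value is already taken within r/2
  of a; injectivity would place z there.\<close>

lemma cauchy_G_bounded_off_atom:
  fixes a r :: real
  assumes \<nu>: "prob_meas_R \<nu>" "mono_inf_div \<nu>" and r: "0 < r"
    and gap: "emeasure \<nu> (ball a r - {a}) = 0" and atom: "0 < measure \<nu> {a}"
    and z: "0 < Im z" "r / 2 < dist (complex_of_real a) z"
  shows "cmod (cauchy_G \<nu> z) < 8 / r"
proof (rule ccontr)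
  assume "\<not> cmod (cauchy_G \<nu> z) < 8 / r"
  then have "8 / r \<le> cmod (cauchy_G \<nu> z)" by simp
  then have "1 / cmod (cauchy_G \<nu> z) \<le> 1 / (8 / r)"
    using r cauchy_G_nonzero[OF \<nu>(1) z(1)] by (intro divide_left_mono) auto
  then have small: "cmod (recip_H \<nu> z) \<le> r / 8" by (simp add: recip_H_def norm_divide)
  have "0 < Im (recip_H \<nu> z)" using pick_map_Im[OF recip_H_pick_map[OF \<nu>(1)] z(1)] z(1) by linarith
  then obtain \<zeta> where \<zeta>: "\<zeta> \<in> cball (complex_of_real a) (r / 2)" "0 < Im \<zeta>" "recip_H \<nu> \<zeta> = recip_H \<nu> z"
    using atom_preimage[OF \<nu>(1) r gap atom _ small] by blast
  have "\<zeta> = z" by (rule recip_H_inj[OF \<nu> \<zeta>(2) z(1) \<zeta>(3)])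
  then show False using \<zeta>(1) z(2) by simp
qed

section \<open>Decomposition of the measure and absence of blow-up\<close>

theorem theorem3p5:
  fixes \<nu> :: "real measure" and a :: real
  assumes "prob_meas_R \<nu>" and "mono_inf_div \<nu>"
    and "0 < measure \<nu> {a}"
    and "a \<notin> closure (supp_meas \<nu> - {a})"
  shows "(\<exists>\<nu>ac :: real measure. finite_measure \<nu>ac \<and> sets \<nu>ac = sets borel
            \<and> absolutely_continuous lborel \<nu>ac
            \<and> (\<forall>A \<in> sets borel. measure \<nu> A = measure \<nu> {a} * indicator A a + measure \<nu>ac A)
            \<and> a \<notin> supp_meas \<nu>ac)
         \<and> {u \<in> supp_meas \<nu> - {a}.
              Limsup (at_right 0) (\<lambda>v::real. ereal (cmod (cauchy_G \<nu> (complex_of_real u + \<i> * complex_of_real v)))) = \<infinity>} = {}"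
proof -
  interpret prob_space \<nu> using assms(1) by (simp add: prob_meas_R_def)
  have sets: "sets \<nu> = sets borel" using assms(1) by (simp add: prob_meas_R_def)
  have space: "space \<nu> = UNIV" using sets_eq_imp_space_eq[OF sets] by simp
  obtain r where r: "0 < r" "ball a r \<inter> (supp_meas \<nu> - {a}) = {}"
  proof -
    have "open (- closure (supp_meas \<nu> - {a}))" by (intro open_Compl closed_closure)
    then obtain r where "0 < r" "ball a r \<subseteq> - closure (supp_meas \<nu> - {a})"
      using assms(4) open_contains_ball by blast
    then show thesis using closure_subset[of "supp_meas \<nu> - {a}"] by (intro that[of r]) auto
  qed
  have gap: "emeasure \<nu> (ball a r - {a}) = 0"
    by (rule emeasure_off_supp[OF sets]) (use r(2) in \<open>auto intro: open_delete\<close>)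
  have bound: "cmod (cauchy_G \<nu> (complex_of_real u + \<i> * complex_of_real v)) < 8 / r"
    if "r \<le> \<bar>u - a\<bar>" "0 < v" for u v
  proof (rule cauchy_G_bounded_off_atom[OF assms(1,2) r(1) gap assms(3)])
    have "r \<le> cmod (complex_of_real a - (complex_of_real u + \<i> * complex_of_real v))"
      using abs_Re_le_cmod[of "complex_of_real a - (complex_of_real u + \<i> * complex_of_real v)"] that(1) by simp
    then show "r / 2 < dist (complex_of_real a) (complex_of_real u + \<i> * complex_of_real v)"
      using r(1) by (simp add: dist_norm)
  qed (use that in simp)
  define \<nu>ac where "\<nu>ac = density \<nu> (indicator (- {a}))"
  have sets_ac: "sets \<nu>ac = sets borel" by (simp add: \<nu>ac_def sets)
  have em_ac: "emeasure \<nu>ac A = emeasure \<nu> (A - {a})" if "A \<in> sets borel" for A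
  proof -
    have "emeasure \<nu>ac A = emeasure \<nu> (- {a} \<inter> A)"
      unfolding \<nu>ac_def using that by (intro emeasure_restricted) (auto simp: sets)
    also have "- {a} \<inter> A = A - {a}" by auto
    finally show ?thesis .
  qed
  have fin: "finite_measure \<nu>ac"
    by (rule finite_measureI) (use em_ac[of UNIV] in \<open>simp add: \<nu>ac_def space\<close>)
  have "absolutely_continuous lborel \<nu>ac"
  proof (rule absolutely_continuous_lipschitz[OF sets_ac])
    \<comment> \<open>An interval inside the ball is null. Any other contains some u with |u - a| >=
      r and lies in [u - v, u + v] for v = d - c, whose measure is at most 2 v |G(u + i v)| <= 2 v
      (8/r).\<close>
    show "0 \<le> 16 / r" using r(1) by simp
    fix c d :: real assume "c < d"
    show "emeasure \<nu>ac {c..d} \<le> ennreal (16 / r * (d - c))"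
    proof (cases "{c..d} \<subseteq> ball a r")
      case True
      have "emeasure \<nu> ({c..d} - {a}) \<le> emeasure \<nu> (ball a r - {a})"
        using True by (intro emeasure_mono) (auto simp: sets)
      then show ?thesis using gap em_ac[of "{c..d}"] by simp
    next
      case False
      then obtain u where "u \<in> {c..d}" "u \<notin> ball a r" by blast
      then have u: "u \<in> {c..d}" "r \<le> \<bar>u - a\<bar>" by (simp_all add: dist_real_def abs_minus_commute)
      have "emeasure \<nu>ac {c..d} \<le> emeasure \<nu> {u - (d - c)..u + (d - c)}"
        using u(1) em_ac[of "{c..d}"] by (auto simp: sets intro!: emeasure_mono)
      also have "\<dots> = ennreal (measure \<nu> {u - (d - c)..u + (d - c)})" by (simp add: emeasure_eq_measure)
      also have "\<dots> \<le> ennreal (16 / r * (d - c))"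
      proof (rule ennreal_leI)
        have "measure \<nu> {u - (d - c)..u + (d - c)}
            \<le> 2 * (d - c) * cmod (cauchy_G \<nu> (complex_of_real u + \<i> * complex_of_real (d - c)))"
          using \<open>c < d\<close> by (intro measure_interval_le_cauchy_G[OF assms(1)]) simp
        also have "\<dots> \<le> 2 * (d - c) * (8 / r)"
          using bound[OF u(2), of "d - c"] \<open>c < d\<close> by (intro mult_left_mono) auto
        finally show "measure \<nu> {u - (d - c)..u + (d - c)} \<le> 16 / r * (d - c)" by (simp add: mult.commute)
      qed
      finally show ?thesis .
    qed
  qed
  moreover have "measure \<nu> A = measure \<nu> {a} * indicator A a + measure \<nu>ac A" if A: "A \<in> sets borel" for A
  proof -
    have ac: "measure \<nu>ac A = measure \<nu> (A - {a})" by (simp add: measure_def em_ac[OF A])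
    show ?thesis
    proof (cases "a \<in> A")
      case True
      then have "A = {a} \<union> (A - {a})" by auto
      then have "measure \<nu> A = measure \<nu> {a} + measure \<nu> (A - {a})"
        using finite_measure_Union[of "{a}" "A - {a}"] A by (simp add: sets)
      then show ?thesis using True ac by simp
    qed (simp add: ac)
  qed
  moreover have "a \<notin> supp_meas \<nu>ac"
    using r(1) gap em_ac[of "ball a r"] by (auto simp: supp_meas_def intro!: exI[of _ r])
  moreover have "Limsup (at_right 0) (\<lambda>v::real. ereal (cmod (cauchy_G \<nu> (complex_of_real u + \<i> * complex_of_real v)))) \<noteq> \<infinity>"
    if u: "u \<in> supp_meas \<nu> - {a}" for u
  proof -
    \<comment> \<open>Support points other than a lie outside the ball, where |G(u + i v)| < 8/r for
      every v > 0.\<close>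
    have "r \<le> \<bar>u - a\<bar>" using u r(2) by (force simp: dist_real_def abs_minus_commute)
    then have "\<forall>\<^sub>F v in at_right 0. ereal (cmod (cauchy_G \<nu> (complex_of_real u + \<i> * complex_of_real v))) \<le> ereal (8 / r)"
      by (intro eventually_at_right_less[THEN eventually_mono]) (simp add: bound less_imp_le)
    then have "Limsup (at_right 0) (\<lambda>v::real. ereal (cmod (cauchy_G \<nu> (complex_of_real u + \<i> * complex_of_real v)))) \<le> ereal (8 / r)"
      by (rule Limsup_bounded)
    then show ?thesis by auto
  qed
  ultimately show ?thesis using fin sets_ac by blast
qed

end
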